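(* There is a constant $c_{113} < 1$ such that $$f_{113}(n) \leq c_{113}\,(1+o(1)) \binom{n}{56},$$ where the $o(1)$ term is as $n \to \infty$.
   Context: An $r$-graph is an $r$-uniform hypergraph. A complete $r$-partite $r$-graph (also called a block) on a ground set $V$ is given by pairwise disjoint nonempty subsets $V_1,\dots,V_r$ of $V$ (not required to have union $V$); its edges are all $r$-element sets containing precisely one vertex from each $V_i$. For positive integers $r, n$, $f_r(n)$ denotes the minimum number of complete $r$-partite $r$-graphs (on subsets of the $n$-element vertex set) needed to partition the edge set of the complete $r$-uniform hypergraph on $n$ vertices, i.e. so that every $r$-element subset of the vertex set is an edge of exactly one of them. *)

theory Defs
  imports Complex_Main "HOL-Library.Disjoint_Sets" "HOL-Library.Ramsey" "HOL-Library.Landau_Symbols"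
begin

(* nsets V r is the set of all r-element subsets of V, i.e. the edge set of the complete
   r-uniform hypergraph on V. *)

definition block_parts :: "nat \<Rightarrow> 'a set \<Rightarrow> (nat \<Rightarrow> 'a set) \<Rightarrow> bool" where
  "block_parts r V P \<longleftrightarrow>
     (\<forall>i\<in>{1..r}. P i \<subseteq> V \<and> P i \<noteq> {}) \<and> disjoint_family_on P {1..r}"

definition block_edges :: "nat \<Rightarrow> 'a set \<Rightarrow> (nat \<Rightarrow> 'a set) \<Rightarrow> 'a set set" where
  "block_edges r V P = {e \<in> nsets V r. \<forall>i\<in>{1..r}. card (e \<inter> P i) = 1}"

(* A block is identified with its edge set. Blocks have at least one edge, so different members
   of a partition into blocks have different edge sets and counting edge sets counts blocks. *)
definition is_block :: "nat \<Rightarrow> 'a set \<Rightarrow> 'a set set \<Rightarrow> bool" where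
  "is_block r V B \<longleftrightarrow> (\<exists>P. block_parts r V P \<and> B = block_edges r V P)"

definition block_partition :: "nat \<Rightarrow> 'a set \<Rightarrow> 'a set set set \<Rightarrow> bool" where
  "block_partition r V F \<longleftrightarrow> partition_on (nsets V r) F \<and> (\<forall>B\<in>F. is_block r V B)"

definition min_blocks :: "nat \<Rightarrow> nat \<Rightarrow> nat" where
  "min_blocks r n = (LEAST m. \<exists>F. block_partition r {..<n} F \<and> card F = m)"

lemma is_block_singleton:
  assumes "e \<in> nsets V r"
  shows "is_block r V {e}"
proof -
  have fin: "finite e" and sub: "e \<subseteq> V" and c: "card e = r"
    using assms by (auto simp: nsets_def)
  obtain h where h: "bij_betw h {1..r} e"
    using ex_bij_betw_nat_finite_1[OF fin] c by auto
  define P where "P = (\<lambda>i. {h i})"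
  have hin: "h i \<in> e" if "i \<in> {1..r}" for i
    using h that by (auto simp: bij_betw_def)
  have "block_parts r V P"
    unfolding block_parts_def disjoint_family_on_def P_def
    using hin sub bij_betw_imp_inj_on[OF h] by (blast dest: inj_onD)
  moreover have "block_edges r V P = {e}"
  proof (intro equalityI subsetI)
    fix x assume "x \<in> block_edges r V P"
    then have x: "finite x" "card x = r" and one: "\<And>i. i \<in> {1..r} \<Longrightarrow> card (x \<inter> {h i}) = 1"
      by (auto simp: block_edges_def nsets_def P_def)
    have "h i \<in> x" if "i \<in> {1..r}" for i
      using one[OF that] by (cases "h i \<in> x") auto
    then have "e \<subseteq> x" using h by (auto simp: bij_betw_def)
    then have "e = x" using card_subset_eq[of x e] x c by simp
    then show "x \<in> {e}" by simp
  next
    fix x assume "x \<in> {e}"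
    then have "x = e" by simp
    moreover have "e \<inter> P i = {h i}" if "i \<in> {1..r}" for i
      using hin[OF that] by (auto simp: P_def)
    ultimately show "x \<in> block_edges r V P"
      using assms by (simp add: block_edges_def)
  qed
  ultimately show ?thesis unfolding is_block_def by blast
qed

lemma block_partition_singletons: "block_partition r V ((\<lambda>e. {e}) ` nsets V r)"
  by (auto simp: block_partition_def partition_on_def disjoint_def is_block_singleton)

lemma min_blocks_attained: "\<exists>F. block_partition r {..<n} F \<and> card F = min_blocks r n"
  unfolding min_blocks_def by (rule LeastI_ex) (use block_partition_singletons in blast)

lemma min_blocks_le: "block_partition r {..<n} F \<Longrightarrow> min_blocks r n \<le> card F"
  unfolding min_blocks_def by (rule Least_le) blast

end

theory Submission
  imports Defs
begin

text \<open>The standard partition of the \<open>r\<close>-subsets of an ordered \<open>n\<close>-set fixes every second vertex, so it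
uses \<open>n choose (r div 2)\<close> blocks. For \<open>r = 113\<close> this is the bound with constant 1, and the point is
to gain a constant factor on it.

Everything is done with counting functions instead of families of blocks. A partition of the
\<open>r\<close>-subsets of \<open>V\<close> into \<open>m\<close> blocks is the same thing as a way of writing the function
\<open>X \<mapsto> card (X \<inter> V) choose r\<close> on finite sets as a sum of \<open>m\<close> products of \<open>r\<close> functions of the form
\<open>X \<mapsto> card (X \<inter> P)\<close> (\<open>min_blocks_le_box_sum\<close>). Such expressions can be added and multiplied, and
Vandermonde's identity splits a binomial coefficient of \<open>card (X \<inter> (A \<union> B))\<close> into products.

The gain comes from pairs of complete graphs. The edges of one complete graph on \<open>s\<close> vertices need about
\<open>s\<close> bicliques, so for a product of two such edge sets one expects to need about \<open>s\<^sup>2\<close> products of two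
bicliques. But the product of the edge sets of \<open>K\<^sub>4\<close> and \<open>K\<^sub>6\<close> splits into 14 such products instead of
\<open>3 * 5 = 15\<close> (\<open>e2_product_identity\<close>), and since a large complete graph is built from blown-up copies
of either graph without loss, \<open>14/15 s\<^sup>2\<close> products suffice in general (\<open>box_sum_edges_product\<close>).

For even size \<open>2 i\<close>, cut the ground set into a large number \<open>t\<close> of equal parts. To leading order,
almost all of the blocks counted by the standard bound serve sets that meet \<open>i\<close> of the parts in exactly
two vertices each. Those sets form products of \<open>i\<close> complete graphs, which are
grouped in pairs, and each pair saves a factor \<open>14/15\<close>. The sets that meet some part in an odd number
of vertices cost a smaller power of the number of vertices. This gives the factor \<open>(14/15) ^ (i div 2)\<close>
asymptotically (\<open>box_sum_even_asymptotic\<close>).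

For size 113, cut the ground set into two halves. One half contains an even number \<open>2 i\<close> of the vertices
and the other an odd number \<open>113 - 2 i\<close>. Use the improved partition for the even part and the standard
one for the odd part. Both halves can play the even role, which costs a factor 2 overall, but the
savings average out to
\<open>(\<Sum>i\<le>56. (56 choose i) * (14/15) ^ (i div 2)) / 2 ^ 56 < 0.43\<close> (\<open>sum_saving\<close>), and \<open>2 * 0.43 < 1\<close>.\<close>

section \<open>Sums of boxes\<close>

definition box :: "'a set list \<Rightarrow> 'a set \<Rightarrow> nat" where
  "box Ps X = (\<Prod>P\<leftarrow>Ps. card (X \<inter> P))"

definition box_sum :: "nat \<Rightarrow> real \<Rightarrow> ('a set \<Rightarrow> nat) \<Rightarrow> bool" where
  "box_sum r m \<phi> \<longleftrightarrow>
     (\<exists>L. (\<forall>Ps\<in>set L. length Ps = r) \<and> real (length L) \<le> m \<and>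
          (\<forall>X. finite X \<longrightarrow> \<phi> X = (\<Sum>Ps\<leftarrow>L. box Ps X)))"

lemma box_sum_mono: "box_sum r m \<phi> \<Longrightarrow> m \<le> m' \<Longrightarrow> box_sum r m' \<phi>"
  unfolding box_sum_def by (meson order_trans)

lemma box_sum_cong:
  assumes "box_sum r m \<phi>" "\<And>X. finite X \<Longrightarrow> \<psi> X = \<phi> X"
  shows "box_sum r m \<psi>"
  using assms unfolding box_sum_def by fastforce

lemma box_sum_zero: "0 \<le> m \<Longrightarrow> box_sum r m (\<lambda>X. 0)"
  unfolding box_sum_def by (rule exI[of _ "[]"]) simp

lemma box_sum_one: "box_sum 0 1 (\<lambda>X. 1)"
  unfolding box_sum_def by (rule exI[of _ "[[]]"]) (simp add: box_def)

lemma box_sum_card: "box_sum 1 1 (\<lambda>X. card (X \<inter> P))"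
  unfolding box_sum_def by (rule exI[of _ "[[P]]"]) (simp add: box_def)

lemma box_sum_add:
  assumes "box_sum r m \<phi>" "box_sum r m' \<psi>"
  shows "box_sum r (m + m') (\<lambda>X. \<phi> X + \<psi> X)"
proof -
  obtain L where L: "\<forall>Ps\<in>set L. length Ps = r" "real (length L) \<le> m"
      "\<And>X. finite X \<Longrightarrow> \<phi> X = (\<Sum>Ps\<leftarrow>L. box Ps X)"
    using assms(1) unfolding box_sum_def by blast
  obtain M where M: "\<forall>Ps\<in>set M. length Ps = r" "real (length M) \<le> m'"
      "\<And>X. finite X \<Longrightarrow> \<psi> X = (\<Sum>Ps\<leftarrow>M. box Ps X)"
    using assms(2) unfolding box_sum_def by blast
  show ?thesis unfolding box_sum_def
    by (rule exI[of _ "L @ M"]) (use L M in auto)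
qed

lemma box_sum_mult:
  assumes "box_sum r m \<phi>" "box_sum r' m' \<psi>"
  shows "box_sum (r + r') (m * m') (\<lambda>X. \<phi> X * \<psi> X)"
proof -
  obtain L where L: "\<forall>Ps\<in>set L. length Ps = r" "real (length L) \<le> m"
      "\<And>X. finite X \<Longrightarrow> \<phi> X = (\<Sum>Ps\<leftarrow>L. box Ps X)"
    using assms(1) unfolding box_sum_def by blast
  obtain M where M: "\<forall>Ps\<in>set M. length Ps = r'" "real (length M) \<le> m'"
      "\<And>X. finite X \<Longrightarrow> \<psi> X = (\<Sum>Ps\<leftarrow>M. box Ps X)"
    using assms(2) unfolding box_sum_def by blast
  define N where "N = concat (map (\<lambda>Ps. map (\<lambda>Qs. Ps @ Qs) M) L)"
  have "\<forall>Ps\<in>set N. length Ps = r + r'"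
    using L(1) M(1) by (auto simp: N_def)
  moreover have "length N = length L * length M"
    unfolding N_def by (induction L) auto
  then have "real (length N) \<le> m * m'"
    using L(2) M(2) by (simp add: mult_mono')
  moreover have "(\<Sum>Ps\<leftarrow>L. box Ps X) * (\<Sum>Ps\<leftarrow>M. box Ps X) = (\<Sum>Ps\<leftarrow>N. box Ps X)" for X
    unfolding N_def
    by (induction L) (simp_all add: box_def distrib_right sum_list_const_mult comp_def)
  ultimately show ?thesis
    unfolding box_sum_def using L(3) M(3) by (intro exI[of _ N]) simp
qed

lemma box_sum_sum:
  assumes "finite I" "\<And>i. i \<in> I \<Longrightarrow> box_sum r (m i) (\<phi> i)"
  shows "box_sum r (\<Sum>i\<in>I. m i) (\<lambda>X. \<Sum>i\<in>I. \<phi> i X)"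
  using assms
proof (induction I rule: finite_induct)
  case empty
  then show ?case by (simp add: box_sum_zero)
next
  case (insert i I)
  then show ?case by (simp add: box_sum_add)
qed

lemma box_sum_linear_form:
  fixes P :: "'i \<Rightarrow> 'a set"
  assumes "disjoint_family_on P J" "I \<subseteq> J" "finite I"
  shows "box_sum 1 1 (\<lambda>X. \<Sum>i\<in>I. card (X \<inter> P i))"
proof (rule box_sum_cong[OF box_sum_card[of "\<Union>i\<in>I. P i"]])
  fix X :: "'a set" assume X: "finite X"
  have "card (X \<inter> (\<Union>i\<in>I. P i)) = card (\<Union>i\<in>I. X \<inter> P i)"
    by (simp only: Int_UN_distrib)
  also have "\<dots> = (\<Sum>i\<in>I. card (X \<inter> P i))"
    using assms X by (intro card_UN_disjoint) (auto simp: disjoint_family_on_def)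
  finally show "(\<Sum>i\<in>I. card (X \<inter> P i)) = card (X \<inter> (\<Union>i\<in>I. P i))" ..
qed

text \<open>Two different members of a list both contribute to the sum; this is what makes a cover by boxes with
total multiplicity 1 a partition.\<close>

lemma sum_list_ge_two:
  fixes f :: "'b \<Rightarrow> nat"
  assumes "a \<in> set L" "b \<in> set L" "a \<noteq> b"
  shows "f a + f b \<le> (\<Sum>x\<leftarrow>L. f x)"
proof -
  have "(\<Sum>x\<leftarrow>L. f x) = f a + (\<Sum>x\<leftarrow>remove1 a L. f x)"
    using assms(1) by (rule sum_list_map_remove1)
  moreover have "b \<in> set (remove1 a L)" using assms by simp
  then have "f b \<le> (\<Sum>x\<leftarrow>remove1 a L. f x)"
    by (intro member_le_sum_list) auto
  ultimately show ?thesis by simp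
qed

lemma prod_list_eq_1_nat: "prod_list (xs :: nat list) = 1 \<longleftrightarrow> (\<forall>x\<in>set xs. x = 1)"
  by (induction xs) auto

text \<open>On an \<open>r\<close>-subset \<open>X\<close> of the ground set the identity reads 1 on the left, so exactly one product is
nonzero, and it is 1: the boxes partition the \<open>r\<close>-subsets. On sets with fewer than \<open>r\<close> elements
the left side is 0, and this forces the parts of each nonempty box to be disjoint. The numbers
\<open>card (X \<inter> P)\<close> thus encode all requirements on a block partition.\<close>

theorem min_blocks_le_box_sum:
  assumes "box_sum r m (\<lambda>X. card (X \<inter> {..<n}) choose r)"
  shows "real (min_blocks r n) \<le> m"
proof -
  let ?V = "{..<n}"
  obtain L where len: "\<And>Ps. Ps \<in> set L \<Longrightarrow> length Ps = r" and m: "real (length L) \<le> m"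
    and eq: "\<And>X. finite X \<Longrightarrow> card (X \<inter> ?V) choose r = (\<Sum>Ps\<leftarrow>L. box Ps X)"
    using assms unfolding box_sum_def by blast
  define part where "part = (\<lambda>Ps i. (Ps ! (i - 1)) \<inter> ?V :: nat set)"
  define B where "B = (\<lambda>Ps. block_edges r ?V (part Ps))"
  have box1: "box Ps e = 1 \<longleftrightarrow> e \<in> B Ps" if Ps: "Ps \<in> set L" and e: "e \<in> nsets ?V r" for Ps e
  proof -
    have "e \<subseteq> ?V" using e by (auto simp: nsets_def)
    then have *: "e \<inter> part Ps i = e \<inter> Ps ! (i - 1)" for i by (auto simp: part_def)
    have "box Ps e = 1 \<longleftrightarrow> (\<forall>P\<in>set Ps. card (e \<inter> P) = 1)"
      unfolding box_def prod_list_eq_1_nat by simp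
    also have "\<dots> \<longleftrightarrow> (\<forall>k<r. card (e \<inter> Ps ! k) = 1)"
      using len[OF Ps] by (auto simp: set_conv_nth)
    also have "\<dots> \<longleftrightarrow> (\<forall>i\<in>{1..r}. card (e \<inter> Ps ! (i - 1)) = 1)"
    proof
      assume H: "\<forall>i\<in>{1..r}. card (e \<inter> Ps ! (i - 1)) = 1"
      show "\<forall>k<r. card (e \<inter> Ps ! k) = 1"
      proof (intro allI impI)
        fix k assume "k < r"
        then show "card (e \<inter> Ps ! k) = 1" using H[rule_format, of "Suc k"] by simp
      qed
    qed auto
    finally show ?thesis using e by (simp add: B_def block_edges_def *)
  qed
  have cover: "\<exists>Ps\<in>set L. e \<in> B Ps" if e: "e \<in> nsets ?V r" for e
  proof -
    have "finite e" "card (e \<inter> ?V) = r" using e by (auto simp: nsets_def Int_absorb2)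
    then have s1: "(\<Sum>Ps\<leftarrow>L. box Ps e) = 1" using eq[of e] by simp
    then have "\<exists>Ps\<in>set L. box Ps e \<noteq> 0" 
      by (metis (no_types, lifting) map_eq_conv sum_list_0 zero_neq_one)
    then obtain Ps where Ps: "Ps \<in> set L" "box Ps e \<noteq> 0" by blast
    moreover have "box Ps e \<le> 1" using Ps(1) s1 member_le_sum_list[of "box Ps e" "map (\<lambda>Ps. box Ps e) L"]
      by auto
    ultimately have "box Ps e = 1" by simp
    then show ?thesis using Ps(1) box1[OF _ e] by blast
  qed
  have uniq: "Ps = Qs" if "Ps \<in> set L" "Qs \<in> set L" "e \<in> B Ps" "e \<in> B Qs" for Ps Qs e
  proof (rule ccontr)
    assume "Ps \<noteq> Qs"
    have e: "e \<in> nsets ?V r" using that(3) by (simp add: B_def block_edges_def)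
    then have "finite e" "card (e \<inter> ?V) = r" by (auto simp: nsets_def Int_absorb2)
    then have "(\<Sum>Ps\<leftarrow>L. box Ps e) = 1" using eq[of e] by simp
    moreover have "box Ps e = 1" "box Qs e = 1" using box1 that e by auto
    ultimately show False
      using sum_list_ge_two[OF that(1,2) \<open>Ps \<noteq> Qs\<close>, of "\<lambda>Ps. box Ps e"] by simp
  qed
  have disj: "disjoint_family_on (part Ps) {1..r}" 
    if Ps: "Ps \<in> set L" and ne: "\<And>i. i \<in> {1..r} \<Longrightarrow> part Ps i \<noteq> {}" for Ps
  proof (rule ccontr)
    assume "\<not> disjoint_family_on (part Ps) {1..r}"
    then obtain i j v where ij: "i \<in> {1..r}" "j \<in> {1..r}" "i \<noteq> j" and v: "v \<in> part Ps i" "v \<in> part Ps j"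
      unfolding disjoint_family_on_def by blast
    have "\<forall>k\<in>{1..r}. \<exists>x. x \<in> part Ps k" using ne by blast
    then obtain p where p: "\<And>k. k \<in> {1..r} \<Longrightarrow> p k \<in> part Ps k" by metis
    \<comment> \<open>A set of fewer than \<open>r\<close> vertices meeting every part: \<open>v\<close> serves two parts at once.\<close>
    define X where "X = insert v (p ` ({1..r} - {i, j}))"
    have fX: "finite X" by (simp add: X_def)
    have "card ({1..r} - {i, j}) = r - 2" using ij by (simp add: card_Diff_subset)
    then have "card (p ` ({1..r} - {i, j})) \<le> r - 2" by (metis card_image_le finite_Diff finite_atLeastAtMost)
    moreover have "r \<ge> 2" using ij by auto
    moreover have "card X \<le> Suc (card (p ` ({1..r} - {i, j})))" by (simp add: X_def card_insert_if)
    ultimately have "card X < r" by linarith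
    then have "card (X \<inter> ?V) < r" using fX by (meson card_mono inf_le1 le_less_trans)
    then have "(\<Sum>Ps\<leftarrow>L. box Ps X) = 0" using eq[OF fX] binomial_eq_0 by metis
    then have "box Ps X = 0" using Ps by simp
    moreover have "card (X \<inter> P) \<noteq> 0" if P: "P \<in> set Ps" for P
    proof -
      obtain k where k: "k < r" "P = Ps ! k" using P len[OF Ps] by (auto simp: set_conv_nth)
      have "\<exists>x\<in>X. x \<in> part Ps (Suc k)"
        using p[of "Suc k"] k(1) v by (cases "Suc k \<in> {i, j}") (auto simp: X_def)
      then have "X \<inter> P \<noteq> {}" using k by (auto simp: part_def)
      then show ?thesis using fX by simp
    qed
    ultimately show False unfolding box_def prod_list_zero_iff by fastforce
  qed
  define F where "F = B ` set L - {{}}"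
  have "is_block r ?V b" if b: "b \<in> F" for b
  proof -
    obtain Ps where Ps: "Ps \<in> set L" "b = B Ps" and "B Ps \<noteq> {}"
      using b unfolding F_def by blast
    then obtain e where e: "e \<in> B Ps" by blast
    have "part Ps i \<noteq> {}" if "i \<in> {1..r}" for i
      using e that unfolding B_def block_edges_def by fastforce
    then have "block_parts r ?V (part Ps)"
      using disj[OF Ps(1)] by (auto simp: block_parts_def part_def)
    then show ?thesis unfolding is_block_def Ps(2) B_def by blast
  qed
  moreover have "partition_on (nsets ?V r) F"
  proof (rule partition_onI)
    have "B Ps \<subseteq> nsets ?V r" for Ps by (auto simp: B_def block_edges_def)
    then show "\<Union> F = nsets ?V r" using cover unfolding F_def by blast
    show "disjnt p q" if "p \<in> F" "q \<in> F" "p \<noteq> q" for p q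
      using that uniq unfolding F_def disjnt_def by blast
    show "{} \<notin> F" by (simp add: F_def)
  qed
  ultimately have "block_partition r ?V F" by (simp add: block_partition_def)
  then have "min_blocks r n \<le> card F" by (rule min_blocks_le)
  also have "\<dots> \<le> card (B ` set L)" unfolding F_def by (rule card_mono) auto
  also have "\<dots> \<le> length L" by (metis List.finite_set card_image_le card_length le_trans)
  finally show ?thesis using m by linarith
qed

section \<open>The trivial partition\<close>

lemma sum_choose_below:
  fixes A :: "'a :: linorder set"
  assumes "finite A"
  shows "(\<Sum>y\<in>A. card (X \<inter> {y}) * (card (X \<inter> {x\<in>A. x < y}) choose r)) = card (X \<inter> A) choose Suc r"
  using assms
proof (induction A rule: finite_linorder_max_induct)
  case empty
  then show ?case by simp
next
  case (insert b A)
  have nb: "b \<notin> A" using insert by auto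
  have A: "{x \<in> insert b A. x < y} = {x\<in>A. x < y}" if "y \<in> A" for y using insert that by force
  have b: "{x \<in> insert b A. x < b} = A" using insert by auto
  have "card (X \<inter> insert b A) = card (X \<inter> {b}) + card (X \<inter> A)"
    using nb insert(1) by (cases "b \<in> X") (auto simp: Int_insert_right)
  moreover have "card (X \<inter> {b}) \<in> {0, 1}" by (cases "b \<in> X") auto
  moreover have "(\<Sum>y\<in>insert b A. card (X \<inter> {y}) * (card (X \<inter> {x\<in>insert b A. x < y}) choose r))
     = card (X \<inter> {b}) * (card (X \<inter> A) choose r)
       + (\<Sum>y\<in>A. card (X \<inter> {y}) * (card (X \<inter> {x\<in>A. x < y}) choose r))"
    using nb insert(1) by (simp add: b A del: insert_iff cong: sum.cong)
  ultimately show ?case using insert.IH by (auto simp del: insert_iff)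
qed

text \<open>An \<open>(r + 2)\<close>-set is classified by its second largest element \<open>y\<close>: it has \<open>r\<close> elements below \<open>y\<close> and one
above.\<close>

lemma sum_choose_between:
  fixes A :: "'a :: linorder set"
  assumes "finite A"
  shows "(\<Sum>y\<in>A. card (X \<inter> {y}) * (card (X \<inter> {x\<in>A. x < y}) choose r) * card (X \<inter> {x\<in>A. y < x}))
           = card (X \<inter> A) choose Suc (Suc r)"
  using assms
proof (induction A rule: finite_linorder_max_induct)
  case empty
  then show ?case by simp
next
  case (insert b A)
  have nb: "b \<notin> A" using insert by auto
  have A: "{x \<in> insert b A. x < y} = {x\<in>A. x < y}" if "y \<in> A" for y using insert that by force
  have ab: "card (X \<inter> {x \<in> insert b A. y < x}) = card (X \<inter> {b}) + card (X \<inter> {x\<in>A. y < x})" if "y \<in> A" for y 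
  proof -
    have "{x \<in> insert b A. y < x} = insert b {x\<in>A. y < x}" using insert that by auto
    then show ?thesis using nb insert(1) by (cases "b \<in> X") (auto simp: Int_insert_right)
  qed
  have b: "{x \<in> insert b A. b < x} = {}" using insert by auto
  have "card (X \<inter> insert b A) = card (X \<inter> {b}) + card (X \<inter> A)"
    using nb insert(1) by (cases "b \<in> X") (auto simp: Int_insert_right)
  moreover have "card (X \<inter> {b}) \<in> {0, 1}" by (cases "b \<in> X") auto
  moreover have "(\<Sum>y\<in>insert b A. card (X \<inter> {y}) * (card (X \<inter> {x\<in>insert b A. x < y}) choose r) * card (X \<inter> {x\<in>insert b A. y < x}))
     = (\<Sum>y\<in>A. card (X \<inter> {y}) * (card (X \<inter> {x\<in>A. x < y}) choose r) * card (X \<inter> {x\<in>A. y < x}))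
       + card (X \<inter> {b}) * (\<Sum>y\<in>A. card (X \<inter> {y}) * (card (X \<inter> {x\<in>A. x < y}) choose r))"
    using nb insert(1) 
    by (simp add: b A ab algebra_simps sum.distrib sum_distrib_left del: insert_iff cong: sum.cong)
  ultimately show ?case using insert.IH sum_choose_below[OF insert(1), of X r]
    by (auto simp del: insert_iff)
qed

text \<open>Every second vertex, counted from the top, becomes a singleton part. Iterating
\<open>sum_choose_between\<close> fixes one vertex for every two elements of the set.\<close>

lemma box_sum_choose:
  fixes A :: "'a :: linorder set"
  assumes "finite A"
  shows "box_sum r (real (card A choose (r div 2))) (\<lambda>X. card (X \<inter> A) choose r)"
  using assms
proof (induction r arbitrary: A rule: induct_nat_012)
  case 0
  then show ?case using box_sum_one by simp
next
  case 1
  then show ?case using box_sum_card by simp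
next
  case (ge2 r)
  let ?lo = "\<lambda>y. {x\<in>A. x < y}" and ?hi = "\<lambda>y. {x\<in>A. y < x}"
  have "box_sum ((1 + r) + 1) (1 * real (card (?lo y) choose (r div 2)) * 1)
      (\<lambda>X. card (X \<inter> {y}) * (card (X \<inter> ?lo y) choose r) * card (X \<inter> ?hi y))" for y
    using ge2 by (intro box_sum_mult box_sum_card) auto
  then have "box_sum (Suc (Suc r)) (\<Sum>y\<in>A. real (card (?lo y) choose (r div 2)))
      (\<lambda>X. \<Sum>y\<in>A. card (X \<inter> {y}) * (card (X \<inter> ?lo y) choose r) * card (X \<inter> ?hi y))"
    using ge2(3) by (intro box_sum_sum) auto
  moreover have "(\<Sum>y\<in>A. card (?lo y) choose (r div 2)) = card A choose Suc (r div 2)"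
  proof -
    have "A \<inter> ?lo y = ?lo y" for y by auto
    moreover have "card (A \<inter> {y}) = 1" if "y \<in> A" for y using that by simp
    ultimately show ?thesis
      using sum_choose_below[OF ge2(3), of A "r div 2"] by (simp cong: sum.cong)
  qed
  ultimately show ?case 
    by (simp add: sum_choose_between[OF ge2(3)] flip: of_nat_sum)
qed

section \<open>Products of two complete graphs\<close>

text \<open>The second elementary symmetric polynomial in \<open>y 0, \<dots>, y k\<close>; with \<open>y j\<close> the number of chosen vertices
in class \<open>j\<close>, it counts the edges between different classes.\<close>

definition e2 :: "nat \<Rightarrow> (nat \<Rightarrow> nat) \<Rightarrow> nat" where
  "e2 k y = (\<Sum>j\<le>k. y j * (\<Sum>i<j. y i))"

lemma choose_two_add: "(a + b) choose 2 = (a choose 2) + b * a + (b choose 2)" for a b :: nat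
proof (induction b)
  case (Suc b)
  have "(a + Suc b) choose 2 = (a + b) + ((a + b) choose 2)" by (simp add: numeral_2_eq_2)
  moreover have "Suc b choose 2 = b + (b choose 2)" by (simp add: numeral_2_eq_2)
  ultimately show ?case using Suc by simp
qed (simp add: numeral_2_eq_2)

lemma choose_two_sum:
  assumes "\<And>j. 0 < j \<Longrightarrow> y j \<le> 1"
  shows "(\<Sum>j\<le>k. y j) choose 2 = (y 0 choose 2) + e2 k y"
proof (induction k)
  case 0
  then show ?case by (simp add: e2_def)
next
  case (Suc k)
  have "y (Suc k) choose 2 = 0" using assms[of "Suc k"] by (intro binomial_eq_0) simp
  then show ?case using Suc
    by (simp add: choose_two_add e2_def lessThan_Suc_atMost)
qed

text \<open>A complete graph is an edge-disjoint union of blown-up copies of a complete graph on \<open>k + 1\<close> vertices: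
split off \<open>k\<close> vertices at a time, with these vertices as singleton classes and all remaining vertices as
one large class. Each copy needs \<open>k\<close> bicliques and removes \<open>k\<close> vertices, so nothing is lost
against one biclique per vertex.\<close>

lemma edges_in_layers:
  assumes "finite A" "card A \<le> k * p"
  shows "\<exists>f :: nat \<Rightarrow> nat \<Rightarrow> 'a set. (\<forall>g<p. disjoint_family_on (f g) {..k}) \<and>
           (\<forall>X. finite X \<longrightarrow> card (X \<inter> A) choose 2 = (\<Sum>g<p. e2 k (\<lambda>j. card (X \<inter> f g j))))"
  using assms
proof (induction p arbitrary: A)
  case 0
  then show ?case by (simp add: numeral_2_eq_2)
next
  case (Suc p)
  obtain D where D: "D \<subseteq> A" "card D = min k (card A)"
    using obtain_subset_with_card_n[of "min k (card A)" A] by auto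
  have fD: "finite D" using D Suc.prems finite_subset by blast
  define A' where "A' = A - D"
  have "card A' = card A - card D" unfolding A'_def using D fD by (simp add: card_Diff_subset)
  then have "card A' \<le> k * p" using D Suc.prems by (auto simp: min_def split: if_splits)
  then obtain f :: "nat \<Rightarrow> nat \<Rightarrow> 'a set" where f: "\<And>g. g < p \<Longrightarrow> disjoint_family_on (f g) {..k}"
    "\<And>X. finite X \<Longrightarrow> card (X \<inter> A') choose 2 = (\<Sum>g<p. e2 k (\<lambda>j. card (X \<inter> f g j)))"
    using Suc.IH[of A'] Suc.prems(1) by (auto simp: A'_def)
  obtain h where h: "bij_betw h {1..card D} D"
    using ex_bij_betw_nat_finite_1[OF fD] by blast
  define l where "l = (\<lambda>j. if j = 0 then A' else if j \<le> card D then {h j} else {})"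
  have hD: "h j \<in> D" if "0 < j" "j \<le> card D" for j
    using h that by (auto simp: bij_betw_def)
  have hinj: "h i \<noteq> h j" if "0 < i" "i \<le> card D" "0 < j" "j \<le> card D" "i \<noteq> j" for i j
    using inj_onD[OF bij_betw_imp_inj_on[OF h], of i j] that by auto
  have disj: "disjoint_family_on l {..k}"
    using hD hinj by (auto simp: disjoint_family_on_def l_def A'_def)
  have A: "(\<Union>j\<in>{..k}. l j) = A"
  proof
    show "(\<Union>j\<in>{..k}. l j) \<subseteq> A" using hD D(1) by (auto simp: l_def A'_def split: if_splits)
    show "A \<subseteq> (\<Union>j\<in>{..k}. l j)"
    proof
      fix x assume x: "x \<in> A"
      show "x \<in> (\<Union>j\<in>{..k}. l j)"
      proof (cases "x \<in> D")
        case True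
        then have "x \<in> h ` {1..card D}" using bij_betw_imp_surj_on[OF h] by simp
        then obtain j where "j \<in> {1..card D}" "h j = x" by blast
        then have "x \<in> l j" "j \<le> k" using D(2) by (auto simp: l_def)
        then show ?thesis by blast
      next
        case False
        then have "x \<in> l 0" using x by (simp add: l_def A'_def)
        then show ?thesis by blast
      qed
    qed
  qed
  have "card (X \<inter> A) choose 2 = (card (X \<inter> A') choose 2) + e2 k (\<lambda>j. card (X \<inter> l j))"
    if X: "finite X" for X
  proof -
    have "card (X \<inter> A) = card (\<Union>j\<in>{..k}. X \<inter> l j)" by (simp only: A[symmetric] Int_UN_distrib)
    also have "\<dots> = (\<Sum>j\<le>k. card (X \<inter> l j))"
      using disj X by (intro card_UN_disjoint) (auto simp: disjoint_family_on_def)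
    finally have "card (X \<inter> A) = (\<Sum>j\<le>k. card (X \<inter> l j))" .
    moreover have "card (X \<inter> l j) \<le> 1" if "0 < j" for j
      using that by (cases "h j \<in> X") (auto simp: l_def)
    ultimately show ?thesis
      using choose_two_sum[of "\<lambda>j. card (X \<inter> l j)" k] by (simp add: l_def)
  qed
  then show ?case
    using f disj by (intro exI[of _ "f(p := l)"] conjI allI impI) (auto simp: less_Suc_eq)
qed

text \<open>The source of the improvement: 14 terms, each a product of four linear forms, whereas expanding each factor
vertex by vertex gives \<open>3 * 5 = 15\<close>.

The idea is to use a different biclique partition of \<open>K\<^sub>4\<close> for different edges of \<open>K\<^sub>6\<close>. Each perfect
matching of \<open>K\<^sub>4\<close> gives a partition into the complementary 4-cycle and the two matching edges.
Let the edges of \<open>K\<^sub>6\<close> be divided into \<open>H\<^sub>0, H\<^sub>1, H\<^sub>2, H\<^sub>3\<close>. For edges in \<open>H\<^sub>i\<close> with \<open>i \<ge> 1\<close> use the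
partition from the \<open>i\<close>-th matching, and for edges in \<open>H\<^sub>0\<close> the six single edges. Each 4-cycle is
multiplied with \<open>H\<^sub>i\<close> and each edge of matching \<open>i\<close> with \<open>H\<^sub>0 \<union> H\<^sub>i\<close>. With \<open>H\<^sub>0\<close> consisting of the edges
03 and 15, the graphs \<open>H\<^sub>1, H\<^sub>2, H\<^sub>3\<close> can be chosen so that each of them is a union of two bicliques, and
\<open>H\<^sub>0 \<union> H\<^sub>1, H\<^sub>0 \<union> H\<^sub>2, H\<^sub>0 \<union> H\<^sub>3\<close> need only 1, 1 and 2. The total is \<open>(2 + 2 + 2) + 2 * (1 + 1 + 2) = 14\<close>.\<close>

lemma e2_product_identity:
  fixes x y :: "nat \<Rightarrow> nat"
  shows "e2 3 x * e2 5 y =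
      x 0 * x 1 * ((y 0 + y 4) * (y 2 + y 3)) + x 0 * x 1 * (y 5 * (y 1 + y 2 + y 4))
    + x 2 * x 3 * ((y 0 + y 4) * (y 2 + y 3)) + x 2 * x 3 * (y 5 * (y 1 + y 2 + y 4))
    + x 0 * x 2 * ((y 0 + y 1) * (y 3 + y 4 + y 5)) + x 1 * x 3 * ((y 0 + y 1) * (y 3 + y 4 + y 5))
    + x 1 * x 2 * ((y 1 + y 3) * (y 0 + y 2 + y 5)) + x 0 * x 3 * ((y 1 + y 3) * (y 0 + y 2 + y 5))
    + (x 0 + x 3) * (x 1 + x 2) * (y 3 * (y 2 + y 5)) + (x 0 + x 3) * (x 1 + x 2) * (y 1 * (y 0 + y 2))
    + (x 0 + x 2) * (x 1 + x 3) * (y 1 * (y 3 + y 4)) + (x 0 + x 2) * (x 1 + x 3) * (y 0 * (y 4 + y 5))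
    + (x 0 + x 1) * (x 2 + x 3) * (y 4 * (y 2 + y 3 + y 5)) + (x 0 + x 1) * (x 2 + x 3) * (y 2 * (y 0 + y 5))"
proof -
  have "e2 3 x = x 1 * x 0 + x 2 * (x 0 + x 1) + x 3 * (x 0 + x 1 + x 2)"
    by (simp add: e2_def eval_nat_numeral)
  moreover have "e2 5 y = y 1 * y 0 + y 2 * (y 0 + y 1) + y 3 * (y 0 + y 1 + y 2)
      + y 4 * (y 0 + y 1 + y 2 + y 3) + y 5 * (y 0 + y 1 + y 2 + y 3 + y 4)"
    by (simp add: e2_def eval_nat_numeral)
  ultimately show ?thesis by (simp only: algebra_simps)
qed

lemma box_sum_e2_product:
  assumes P: "disjoint_family_on P {..3::nat}" and Q: "disjoint_family_on Q {..5::nat}"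
  shows "box_sum 4 14 (\<lambda>X. e2 3 (\<lambda>j. card (X \<inter> P j)) * e2 5 (\<lambda>j. card (X \<inter> Q j)))"
proof -
  define x where "x = (\<lambda>I X. \<Sum>i\<in>I. card (X \<inter> P i))"
  define y where "y = (\<lambda>I X. \<Sum>i\<in>I. card (X \<inter> Q i))"
  have four: "box_sum 4 1 (\<lambda>X. x I X * x I' X * (y J X * y J' X))"
    if "I \<subseteq> {..3}" "I' \<subseteq> {..3}" "J \<subseteq> {..5}" "J' \<subseteq> {..5}" for I I' J J'
  proof -
    have "box_sum ((1 + 1) + (1 + 1)) ((1 * 1) * (1 * 1)) (\<lambda>X. x I X * x I' X * (y J X * y J' X))"
      unfolding x_def y_def using that P Q
      by (intro box_sum_mult box_sum_linear_form) (auto intro: finite_subset)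
    then show ?thesis by (simp add: eval_nat_numeral)
  qed
  note sum14 = box_sum_add[OF box_sum_add[OF box_sum_add[OF box_sum_add[OF box_sum_add[OF box_sum_add[OF
    box_sum_add[OF box_sum_add[OF box_sum_add[OF box_sum_add[OF box_sum_add[OF box_sum_add[OF box_sum_add[OF
      four[of "{0}" "{1}" "{0,4}" "{2,3}"] four[of "{0}" "{1}" "{5}" "{1,2,4}"]]
      four[of "{2}" "{3}" "{0,4}" "{2,3}"]] four[of "{2}" "{3}" "{5}" "{1,2,4}"]]
      four[of "{0}" "{2}" "{0,1}" "{3,4,5}"]] four[of "{1}" "{3}" "{0,1}" "{3,4,5}"]]
      four[of "{1}" "{2}" "{1,3}" "{0,2,5}"]] four[of "{0}" "{3}" "{1,3}" "{0,2,5}"]]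
      four[of "{0,3}" "{1,2}" "{3}" "{2,5}"]] four[of "{0,3}" "{1,2}" "{1}" "{0,2}"]]
      four[of "{0,2}" "{1,3}" "{1}" "{3,4}"]] four[of "{0,2}" "{1,3}" "{0}" "{4,5}"]]
      four[of "{0,1}" "{2,3}" "{4}" "{2,3,5}"]] four[of "{0,1}" "{2,3}" "{2}" "{0,5}"]]
  show ?thesis
    by (rule box_sum_cong[OF box_sum_mono[OF sum14]])
       (simp_all add: e2_product_identity x_def y_def add.assoc)
qed

abbreviation edges :: "'a set \<Rightarrow> 'a set \<Rightarrow> nat" where
  "edges A X \<equiv> card (X \<inter> A) choose 2"

text \<open>With \<open>15 u\<close> vertices on both sides, use \<open>5 u\<close> copies of \<open>K\<^sub>4\<close> on the left and \<open>3 u\<close> copies of \<open>K\<^sub>6\<close> on the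
right, at 14 boxes for each pair of copies.\<close>

lemma box_sum_edges_product:
  assumes "finite A" "card A \<le> 15 * u" "finite B" "card B \<le> 15 * u"
  shows "box_sum 4 (14 / 15 * real (15 * u) ^ 2) (\<lambda>X. edges A X * edges B X)"
proof -
  have card: "card A \<le> 3 * (5 * u)" "card B \<le> 5 * (3 * u)" using assms by auto
  obtain f where f: "\<And>g. g < 5 * u \<Longrightarrow> disjoint_family_on (f g) {..3}"
    "\<And>X. finite X \<Longrightarrow> edges A X = (\<Sum>g<5 * u. e2 3 (\<lambda>j. card (X \<inter> f g j)))"
    using edges_in_layers[OF assms(1) card(1)] by blast
  obtain f' where f': "\<And>g. g < 3 * u \<Longrightarrow> disjoint_family_on (f' g) {..5}"
    "\<And>X. finite X \<Longrightarrow> edges B X = (\<Sum>g<3 * u. e2 5 (\<lambda>j. card (X \<inter> f' g j)))"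
    using edges_in_layers[OF assms(3) card(2)] by blast
  have layers: "box_sum 4 (\<Sum>g<5 * u. \<Sum>g'<3 * u. 14)
    (\<lambda>X. \<Sum>g<5 * u. \<Sum>g'<3 * u. e2 3 (\<lambda>j. card (X \<inter> f g j)) * e2 5 (\<lambda>j. card (X \<inter> f' g' j)))"
    using f(1) f'(1) by (intro box_sum_sum box_sum_e2_product) auto
  show ?thesis
  proof (rule box_sum_cong[OF box_sum_mono[OF layers]])
    show "(\<Sum>g<5 * u. \<Sum>g'<3 * u. 14) \<le> 14 / 15 * real (15 * u) ^ 2"
      by (simp add: power2_eq_square)
  next
    fix X :: "'a set" assume "finite X"
    then show "edges A X * edges B X = (\<Sum>g<5 * u. \<Sum>g'<3 * u.
        e2 3 (\<lambda>j. card (X \<inter> f g j)) * e2 5 (\<lambda>j. card (X \<inter> f' g' j)))"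
      by (simp only: f(2) f'(2) sum_product)
  qed
qed

section \<open>Sets of even size\<close>

lemma box_sum_edges:
  fixes A :: "'a :: linorder set"
  assumes "finite A" "card A \<le> s"
  shows "box_sum 2 (real s) (edges A)"
  using box_sum_mono[OF box_sum_choose[of A 2]] assms by simp

abbreviation saving :: "nat \<Rightarrow> real" where
  "saving i \<equiv> (14 / 15) ^ (i div 2)"

text \<open>The \<open>i\<close>-th elementary symmetric polynomial in the edge counts of the parts \<open>A 0, \<dots>, A (t - 1)\<close>: it
counts the sets that meet \<open>i\<close> of these parts in two vertices each and avoid the others.\<close>

fun esym_edges :: "(nat \<Rightarrow> 'a set) \<Rightarrow> nat \<Rightarrow> nat \<Rightarrow> 'a set \<Rightarrow> nat" where
  "esym_edges A t 0 X = 1"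
| "esym_edges A 0 (Suc i) X = 0"
| "esym_edges A (Suc t) (Suc i) X = esym_edges A t (Suc i) X + edges (A t) X * esym_edges A t i X"

text \<open>The complete graphs in a product have to be paired up, while the recursion for \<open>esym_edges\<close> brings them
in one at a time. The second claim handles this: \<open>B\<close> is a complete graph still waiting for a partner.\<close>

lemma box_sum_esym_edges:
  fixes A :: "nat \<Rightarrow> 'a :: linorder set"
  assumes "s = 15 * u" "\<And>j. j < t \<Longrightarrow> finite (A j) \<and> card (A j) \<le> s"
  shows "box_sum (2 * i) (real (t choose i) * (saving i * real s ^ i)) (esym_edges A t i) \<and>
         (\<forall>B. finite B \<longrightarrow> card B \<le> s \<longrightarrow>
           box_sum (2 + 2 * i) (real (t choose i) * (saving (Suc i) * real s ^ Suc i))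
             (\<lambda>X. edges B X * esym_edges A t i X))"
  using assms(2)
proof (induction t arbitrary: i)
  case 0
  then show ?case
    by (cases i) (simp_all add: box_sum_one[simplified] box_sum_edges box_sum_zero)
next
  case (Suc t)
  have At: "finite (A t)" "card (A t) \<le> s" using Suc.prems by auto
  have IH1: "box_sum (2 * i) (real (t choose i) * (saving i * real s ^ i)) (esym_edges A t i)" for i
    using Suc by auto
  have IH2: "box_sum (2 + 2 * i) (real (t choose i) * (saving (Suc i) * real s ^ Suc i))
             (\<lambda>X. edges B X * esym_edges A t i X)" if "finite B" "card B \<le> s" for i B
    using Suc that by auto
  show ?case
  proof (cases i)
    case 0
    then show ?thesis by (simp add: box_sum_one[simplified] box_sum_edges)
  next
    case i: (Suc k)
    from box_sum_add[OF IH1[of "Suc k"] IH2[OF At, of k, folded mult_Suc_right]]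
    have "box_sum (2 * Suc k) (real (Suc t choose Suc k) * (saving (Suc k) * real s ^ Suc k))
            (esym_edges A (Suc t) (Suc k))"
      by (rule box_sum_cong[OF box_sum_mono]) (simp_all add: algebra_simps)
    moreover have "box_sum (2 + 2 * Suc k)
        (real (Suc t choose Suc k) * (saving (Suc (Suc k)) * real s ^ Suc (Suc k)))
        (\<lambda>X. edges B X * esym_edges A (Suc t) (Suc k) X)"
      if B: "finite B" "card B \<le> s" for B
    proof -
      have "box_sum 4 (14 / 15 * real s ^ 2) (\<lambda>X. edges B X * edges (A t) X)"
        using B At unfolding assms(1) by (intro box_sum_edges_product)
      from box_sum_mult[OF this IH1[of k]]
      have "box_sum (2 + 2 * Suc k)
          (14 / 15 * real s ^ 2 * (real (t choose k) * (saving k * real s ^ k)))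
          (\<lambda>X. edges B X * edges (A t) X * esym_edges A t k X)"
        by (simp add: eval_nat_numeral)
      from box_sum_add[OF IH2[OF B, of "Suc k"] this]
      show ?thesis
        by (rule box_sum_cong[OF box_sum_mono]) (simp_all add: algebra_simps power2_eq_square)
    qed
    ultimately show ?thesis unfolding i by blast
  qed
qed

lemma sum_even_odd:
  fixes g :: "nat \<Rightarrow> 'b :: comm_monoid_add"
  shows "(\<Sum>b\<le>Suc (2 * n). g b) = (\<Sum>j\<le>n. g (2 * j)) + (\<Sum>j\<le>n. g (Suc (2 * j)))"
    and "(\<Sum>b\<le>2 * Suc n. g b) = (\<Sum>j\<le>Suc n. g (2 * j)) + (\<Sum>j\<le>n. g (Suc (2 * j)))"
proof -
  show odd: "(\<Sum>b\<le>Suc (2 * n). g b) = (\<Sum>j\<le>n. g (2 * j)) + (\<Sum>j\<le>n. g (Suc (2 * j)))"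
    by (induction n) (simp_all add: ac_simps)
  show "(\<Sum>b\<le>2 * Suc n. g b) = (\<Sum>j\<le>Suc n. g (2 * j)) + (\<Sum>j\<le>n. g (Suc (2 * j)))"
    using odd by (simp add: ac_simps)
qed

text \<open>The cost of all ways to distribute \<open>2 (i + 1)\<close> vertices on two parts. Even splits make up the leading
binomial coefficient, while an odd split loses one half in each of the two parts and so contributes to a
binomial coefficient of lower order.\<close>

lemma sum_choose_halves:
  "(\<Sum>b\<le>2 * Suc i. (s choose (b div 2)) * (z choose ((2 * Suc i - b) div 2)))
     = ((s + z) choose Suc i) + ((s + z) choose i)"
proof -
  let ?g = "\<lambda>b. (s choose (b div 2)) * (z choose ((2 * Suc i - b) div 2))"
  have even: "?g (2 * j) = (s choose j) * (z choose (Suc i - j))" for j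
  proof -
    have "(2 * Suc i - 2 * j) div 2 = Suc i - j" "(2 * j) div 2 = j" by presburger+
    then show ?thesis by simp
  qed
  have odd: "?g (Suc (2 * j)) = (s choose j) * (z choose (i - j))" for j
  proof -
    have "(2 * Suc i - Suc (2 * j)) div 2 = i - j" "Suc (2 * j) div 2 = j" by presburger+
    then show ?thesis by simp
  qed
  show ?thesis unfolding sum_even_odd(2)[of ?g i] even odd vandermonde ..
qed

lemma card_Int_Un_choose:
  assumes "finite X" "A \<inter> B = {}"
  shows "card (X \<inter> (A \<union> B)) choose r
    = (\<Sum>b\<le>r. (card (X \<inter> A) choose b) * (card (X \<inter> B) choose (r - b)))"
proof -
  have "card (X \<inter> (A \<union> B)) = card (X \<inter> A) + card (X \<inter> B)"
    unfolding Int_Un_distrib using assms by (intro card_Un_disjoint) auto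
  then show ?thesis by (simp add: vandermonde)
qed

lemma box_sum_two_parts:
  fixes A :: "'a :: linorder set"
  assumes "finite A" "card A \<le> a" "finite B" "card B \<le> b" "p \<le> r"
  shows "box_sum r (real ((a choose (p div 2)) * (b choose ((r - p) div 2))))
           (\<lambda>X. (card (X \<inter> A) choose p) * (card (X \<inter> B) choose (r - p)))"
proof -
  have "box_sum (p + (r - p)) (real (card A choose (p div 2)) * real (card B choose ((r - p) div 2)))
           (\<lambda>X. (card (X \<inter> A) choose p) * (card (X \<inter> B) choose (r - p)))"
    using assms by (intro box_sum_mult box_sum_choose)
  moreover have "real (card A choose (p div 2)) * real (card B choose ((r - p) div 2))
      \<le> real ((a choose (p div 2)) * (b choose ((r - p) div 2)))"
    using assms by (simp add: mult_mono binomial_right_mono flip: of_nat_mult)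
  ultimately show ?thesis using assms(5) by (auto intro: box_sum_mono)
qed

text \<open>The sets not counted by \<open>esym_edges\<close> are partitioned in the standard way. If all parts are met in an
even number of vertices, the total cost would be \<open>(t s) choose i\<close>, of which \<open>(t choose i) s ^ i\<close> belongs
to \<open>esym_edges\<close> and is subtracted. The last term pays for all splits with odd intersections and is of
lower order in \<open>s\<close>.\<close>

lemma box_sum_remainder:
  fixes A :: "nat \<Rightarrow> 'a :: linorder set"
  assumes "\<And>j. j < t \<Longrightarrow> finite (A j) \<and> card (A j) \<le> s" "disjoint_family_on A {..<t}"
  shows "\<exists>R. (\<forall>X. finite X \<longrightarrow>
             card (X \<inter> (\<Union>j<t. A j)) choose (2 * i) = esym_edges A t i X + R X) \<and>
           box_sum (2 * i)
             (real ((t * s) choose i) - real (t choose i) * real s ^ i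
               + real (i * t * ((t * s) choose (i - 1)))) R"
  using assms
proof (induction t arbitrary: i)
  case 0
  then show ?case by (intro exI[of _ "\<lambda>X. 0"], cases i) (auto simp: box_sum_zero)
next
  case (Suc t)
  show ?case
  proof (cases i)
    case 0
    then show ?thesis by (intro exI[of _ "\<lambda>X. 0"]) (auto simp: box_sum_zero)
  next
    case i: (Suc k)
    let ?U = "\<Union>j<t. A j"
    have fam: "\<And>j. j < t \<Longrightarrow> finite (A j) \<and> card (A j) \<le> s" "disjoint_family_on A {..<t}"
      using Suc.prems by (auto simp: disjoint_family_on_def)
    have At: "finite (A t)" "card (A t) \<le> s" using Suc.prems(1) by auto
    have U: "finite ?U" using fam(1) by auto
    have "card ?U \<le> (\<Sum>j<t. card (A j))" by (rule card_UN_le) simp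
    also have "\<dots> \<le> t * s" using sum_bounded_above[of "{..<t}" "\<lambda>j. card (A j)" s] fam(1) by simp
    finally have cU: "card ?U \<le> t * s" .
    obtain R1 where R1: "\<And>X. finite X \<Longrightarrow> card (X \<inter> ?U) choose (2 * Suc k) = esym_edges A t (Suc k) X + R1 X"
      "box_sum (2 * Suc k) (real ((t * s) choose Suc k) - real (t choose Suc k) * real s ^ Suc k
               + real (Suc k * t * ((t * s) choose k))) R1"
      using Suc.IH[OF fam, of "Suc k"] by auto
    obtain R0 where R0: "\<And>X. finite X \<Longrightarrow> card (X \<inter> ?U) choose (2 * k) = esym_edges A t k X + R0 X"
      "box_sum (2 * k) (real ((t * s) choose k) - real (t choose k) * real s ^ k
               + real (k * t * ((t * s) choose (k - 1)))) R0"
      using Suc.IH[OF fam, of k] by auto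
    \<comment> \<open>The new part contains \<open>b\<close> vertices; \<open>b = 0\<close> and \<open>b = 2\<close> feed the two earlier remainders and \<open>esym_edges\<close>.\<close>
    let ?J = "{..2 * Suc k} - {0, 2}"
    let ?f = "\<lambda>X b. (card (X \<inter> A t) choose b) * (card (X \<inter> ?U) choose (2 * Suc k - b))"
    let ?c = "\<lambda>b. (s choose (b div 2)) * ((t * s) choose ((2 * Suc k - b) div 2))"
    define R where "R = (\<lambda>X. R1 X + edges (A t) X * R0 X + (\<Sum>b\<in>?J. ?f X b))"
    have split: "(\<Sum>b\<le>2 * Suc k. g b) = g 0 + g 2 + (\<Sum>b\<in>?J. g b)" for g :: "nat \<Rightarrow> nat"
    proof -
      have "(\<Sum>b\<le>2 * Suc k. g b) = (\<Sum>b\<in>?J. g b) + (\<Sum>b\<in>{0, 2}. g b)"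
        by (rule sum.subset_diff) auto
      then show ?thesis by simp
    qed
    have "card (X \<inter> (\<Union>j<Suc t. A j)) choose (2 * i) = esym_edges A (Suc t) i X + R X"
      if X: "finite X" for X
    proof -
      have "(\<Union>j<Suc t. A j) = A t \<union> ?U" by (auto simp: less_Suc_eq)
      moreover have "A t \<inter> A j = {}" if "j < t" for j
        using Suc.prems(2) that by (auto simp: disjoint_family_on_def)
      then have "A t \<inter> ?U = {}" by blast
      ultimately have "card (X \<inter> (\<Union>j<Suc t. A j)) choose (2 * i) = (\<Sum>b\<le>2 * Suc k. ?f X b)"
        unfolding i by (simp only: card_Int_Un_choose[OF X])
      also have "\<dots> = (card (X \<inter> ?U) choose (2 * Suc k)) + edges (A t) X * (card (X \<inter> ?U) choose (2 * k))
          + (\<Sum>b\<in>?J. ?f X b)"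
        unfolding split by simp
      also have "\<dots> = esym_edges A (Suc t) i X + R X"
        unfolding R1(1)[OF X] R0(1)[OF X] R_def i by (simp add: algebra_simps)
      finally show ?thesis .
    qed
    moreover have "box_sum (2 * i)
             (real ((Suc t * s) choose i) - real (Suc t choose i) * real s ^ i
               + real (i * Suc t * ((Suc t * s) choose (i - 1)))) R"
    proof -
      have "box_sum (2 + 2 * k) (real s * (real ((t * s) choose k) - real (t choose k) * real s ^ k
               + real (k * t * ((t * s) choose (k - 1))))) (\<lambda>X. edges (A t) X * R0 X)"
        using R0(2) At by (intro box_sum_mult box_sum_edges)
      moreover have "box_sum (2 * Suc k) (\<Sum>b\<in>?J. real (?c b)) (\<lambda>X. \<Sum>b\<in>?J. ?f X b)"
        using At U cU by (intro box_sum_sum box_sum_two_parts) auto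
      ultimately have *: "box_sum (2 * Suc k)
          ((real ((t * s) choose Suc k) - real (t choose Suc k) * real s ^ Suc k
               + real (Suc k * t * ((t * s) choose k)))
           + real s * (real ((t * s) choose k) - real (t choose k) * real s ^ k
               + real (k * t * ((t * s) choose (k - 1))))
           + (\<Sum>b\<in>?J. real (?c b))) R"
        using R1(2) unfolding R_def by (intro box_sum_add) auto
      have "((t * s) choose Suc k) + s * ((t * s) choose k) + (\<Sum>b\<in>?J. ?c b)
          = ((Suc t * s) choose Suc k) + ((Suc t * s) choose k)"
        using split[of ?c] sum_choose_halves[where i = k and s = s and z = "t * s"] by simp
      from arg_cong[OF this, of real]
      have sum: "real ((t * s) choose Suc k) + real s * real ((t * s) choose k) + (\<Sum>b\<in>?J. real (?c b))
          = real ((Suc t * s) choose Suc k) + real ((Suc t * s) choose k)"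
        by simp
      have step: "Suc k * ((t * s) choose k) + s * (k * ((t * s) choose (k - 1)))
          \<le> Suc k * ((Suc t * s) choose k)"
      proof (cases k)
        case k: (Suc j)
        have "((Suc t * s) choose k) = (\<Sum>b\<le>k. (s choose b) * ((t * s) choose (k - b)))"
          unfolding vandermonde by simp
        also have "\<dots> \<ge> (\<Sum>b\<in>{0, 1}. (s choose b) * ((t * s) choose (k - b)))"
          by (rule sum_mono2) (auto simp: k)
        finally have "((t * s) choose k) + s * ((t * s) choose j) \<le> ((Suc t * s) choose k)"
          by (simp add: k)
        from mult_le_mono2[OF this, of "Suc k"] show ?thesis
          by (simp add: k algebra_simps)
      qed simp
      have "t * (Suc k * ((t * s) choose k) + s * (k * ((t * s) choose (k - 1)))) + ((Suc t * s) choose k)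
          \<le> Suc k * Suc t * ((Suc t * s) choose k)"
        using mult_le_mono2[OF step, of t] by (simp add: algebra_simps)
      then have "real t * (real (Suc k) * real ((t * s) choose k) + real s * (real k * real ((t * s) choose (k - 1))))
           + real ((Suc t * s) choose k) \<le> real (Suc k * Suc t * ((Suc t * s) choose k))"
        unfolding of_nat_mult[symmetric] of_nat_add[symmetric] of_nat_le_iff .
      moreover have "real (Suc t choose Suc k) = real (t choose Suc k) + real (t choose k)" by simp
      ultimately show ?thesis unfolding i using sum
        by (intro box_sum_mono[OF *]) (simp add: algebra_simps)
    qed
    ultimately show ?thesis by blast
  qed
qed

lemma partition_into_small_parts:
  assumes "finite A" "card A \<le> t * s"
  shows "\<exists>P :: nat \<Rightarrow> 'a set. disjoint_family_on P {..<t} \<and> (\<Union>j<t. P j) = A \<and>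
           (\<forall>j<t. finite (P j) \<and> card (P j) \<le> s)"
  using assms
proof (induction t arbitrary: A)
  case 0
  then show ?case by (simp add: disjoint_family_on_def)
next
  case (Suc t)
  obtain D where D: "D \<subseteq> A" "card D = min s (card A)"
    using obtain_subset_with_card_n[of "min s (card A)" A] by auto
  have fD: "finite D" using D Suc.prems finite_subset by blast
  have "card (A - D) = card A - card D" using D fD by (simp add: card_Diff_subset)
  then have "card (A - D) \<le> t * s" using D Suc.prems by (auto simp: min_def split: if_splits)
  then obtain P :: "nat \<Rightarrow> 'a set" where P: "disjoint_family_on P {..<t}" "(\<Union>j<t. P j) = A - D"
      "\<forall>j<t. finite (P j) \<and> card (P j) \<le> s"
    using Suc.IH[of "A - D"] Suc.prems(1) by auto
  define Q where "Q = (\<lambda>j. if j < t then P j else D)"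
  have Q: "Q j = P j" if "j < t" for j using that by (simp add: Q_def)
  have Qt: "Q t = D" by (simp add: Q_def)
  have PD: "P j \<inter> D = {}" "D \<inter> P j = {}" if "j < t" for j using P(2) that by blast+
  have "disjoint_family_on Q {..<Suc t}"
    unfolding disjoint_family_on_def
  proof (intro ballI impI)
    fix m n assume "m \<in> {..<Suc t}" "n \<in> {..<Suc t}" "m \<noteq> n"
    then consider "m < t" "n < t" | "m < t" "n = t" | "m = t" "n < t" by fastforce
    then show "Q m \<inter> Q n = {}"
      using PD disjoint_family_onD[OF P(1) _ _ \<open>m \<noteq> n\<close>] by cases (simp_all add: Q Qt)
  qed
  moreover have "(\<Union>j<Suc t. Q j) = A"
  proof -
    have "(\<Union>j<Suc t. Q j) = Q t \<union> (\<Union>j<t. Q j)" by (simp add: lessThan_Suc)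
    also have "(\<Union>j<t. Q j) = (\<Union>j<t. P j)" by (intro SUP_cong) (simp_all add: Q)
    also have "Q t \<union> \<dots> = A" using P(2) Qt D(1) by blast
    finally show ?thesis .
  qed
  moreover have "finite (Q j) \<and> card (Q j) \<le> s" if "j < Suc t" for j
    using P(3) fD D(2) that by (cases "j < t") (simp_all add: Q_def)
  ultimately show ?case by blast
qed

section \<open>Asymptotics\<close>

lemma choose_asymptotics: "(\<lambda>n. real (n choose k) * fact k / real n ^ k) \<longlonglongrightarrow> 1"
proof -
  have "(\<lambda>n. \<Prod>i<k. 1 - real i * inverse (real n)) \<longlonglongrightarrow> (\<Prod>i<k. 1 - real i * 0)"
    by (intro tendsto_intros lim_inverse_n)
  moreover have "eventually (\<lambda>n. (\<Prod>i<k. 1 - real i * inverse (real n))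
      = real (n choose k) * fact k / real n ^ k) sequentially"
    using eventually_gt_at_top[of 0]
  proof eventually_elim
    case (elim n)
    have "real (n choose k) * fact k = (\<Prod>i<k. real n - real i)"
      by (simp add: binomial_gbinomial gbinomial_prod_rev atLeast0LessThan)
    also have "\<dots> / real n ^ k = (\<Prod>i<k. (real n - real i) / real n)"
      by (simp add: prod_dividef)
    finally show ?case using elim by (simp add: field_simps)
  qed
  ultimately show ?thesis by (simp add: tendsto_cong)
qed

lemma box_sum_even:
  fixes A :: "'a :: linorder set"
  assumes "finite A" "card A \<le> t * (15 * u)"
  shows "box_sum (2 * i)
     (real (t choose i) * (saving i * real (15 * u) ^ i)
       + (real ((t * (15 * u)) choose i) - real (t choose i) * real (15 * u) ^ i
       + real (i * t * ((t * (15 * u)) choose (i - 1)))))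
     (\<lambda>X. card (X \<inter> A) choose (2 * i))"
proof -
  obtain P where P: "disjoint_family_on P {..<t}" "(\<Union>j<t. P j) = A"
      "\<And>j. j < t \<Longrightarrow> finite (P j) \<and> card (P j) \<le> 15 * u"
    using partition_into_small_parts[OF assms] by (elim exE conjE) simp
  obtain R where R: "\<forall>X. finite X \<longrightarrow> card (X \<inter> (\<Union>j<t. P j)) choose (2 * i) = esym_edges P t i X + R X"
    "box_sum (2 * i) (real ((t * (15 * u)) choose i) - real (t choose i) * real (15 * u) ^ i
               + real (i * t * ((t * (15 * u)) choose (i - 1)))) R"
    by (rule exE[OF box_sum_remainder[OF P(3,1), of i]]) (assumption, elim conjE, rule that)
  have "box_sum (2 * i) (real (t choose i) * (saving i * real (15 * u) ^ i)) (esym_edges P t i)"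
    using P(3) by (intro box_sum_esym_edges[THEN conjunct1, OF refl]) auto
  from box_sum_add[OF this R(2)] show ?thesis
  proof (rule box_sum_cong)
    fix X :: "'a set" assume "finite X"
    then show "card (X \<inter> A) choose (2 * i) = esym_edges P t i X + R X"
      using R(1) unfolding P(2) by simp
  qed
qed

lemma choose_le_power: "real (n choose k) \<le> real n ^ k / fact k"
proof -
  have "real ((n choose k) * fact k) \<le> real (n ^ k)"
    by (intro of_nat_mono binomial_fact_pow)
  then show ?thesis by (simp add: field_simps)
qed

text \<open>In \<open>box_sum_even\<close> the fraction \<open>(t choose i) * i! / t ^ i\<close> of the leading term gets the factor
\<open>saving i\<close>. This fraction tends to 1 for large \<open>t\<close>; so fix such a \<open>t\<close> first, and then let the
size of the ground set grow, which makes rounding and the term of lower order negligible.\<close>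

lemma box_sum_even_asymptotic:
  assumes "0 < \<delta>"
  shows "eventually (\<lambda>N. \<forall>A :: 'a :: linorder set. finite A \<longrightarrow> card A \<le> N \<longrightarrow>
     box_sum (2 * i) ((saving i + \<delta>) * real N ^ i / fact i) (\<lambda>X. card (X \<inter> A) choose (2 * i)))
     sequentially"
proof -
  have a: "0 \<le> saving i" "saving i \<le> 1" by (simp_all add: power_le_one)
  have "eventually (\<lambda>t. real (t choose i) * fact i / real t ^ i > 1 - \<delta> / 2) sequentially"
    using order_tendstoD(1)[OF choose_asymptotics[of i], of "1 - \<delta> / 2"] assms by simp
  then obtain t where t: "t > 0" "real (t choose i) * fact i / real t ^ i > 1 - \<delta> / 2"
    by (metis (mono_tags, lifting) eventually_at_top_linorder eventually_conj eventually_gt_at_top order_refl)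
  define M where "M = (\<lambda>N. real N + 15 * real t)"
  define C where "C = (\<lambda>N. (saving i + \<delta> / 2) / fact i * M N ^ i + real i * real t * M N ^ (i - 1))"
  have bound: "box_sum (2 * i) (C N) (\<lambda>X. card (X \<inter> A) choose (2 * i))"
    if A: "finite A" "card A \<le> N" for A :: "'a set" and N
  proof -
    \<comment> \<open>Part sizes are rounded up to a multiple of 15; altogether this adds at most \<open>15 t\<close> vertices.\<close>
    define u where "u = N div (15 * t) + 1"
    let ?s = "15 * u"
    have ts: "t * ?s = 15 * t * (N div (15 * t)) + 15 * t" by (simp add: u_def algebra_simps)
    have "N = 15 * t * (N div (15 * t)) + N mod (15 * t)" by simp
    moreover have "N mod (15 * t) < 15 * t" using t by simp
    ultimately have "N \<le> t * ?s" "t * ?s \<le> N + 15 * t" unfolding ts by linarith+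
    then have N: "card A \<le> t * ?s" and "real (t * ?s) \<le> real (N + 15 * t)"
      using A(2) by (linarith, simp only: of_nat_le_iff)
    then have M: "real (t * ?s) \<le> M N" by (simp add: M_def)
    have s: "real ?s ^ i = real (t * ?s) ^ i / real t ^ i" using t(1) by (simp add: power_mult_distrib)
    have "real (t choose i) * (saving i * real ?s ^ i)
       + (real ((t * ?s) choose i) - real (t choose i) * real ?s ^ i
       + real (i * t * ((t * ?s) choose (i - 1))))
       = real ((t * ?s) choose i) - (1 - saving i) * (real (t choose i) * real ?s ^ i)
         + real i * real t * real ((t * ?s) choose (i - 1))"
      by (simp add: algebra_simps)
    also have "\<dots> \<le> real (t * ?s) ^ i / fact i
         - (1 - saving i) * ((1 - \<delta> / 2) * (real (t * ?s) ^ i / fact i))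
         + real i * real t * real (t * ?s) ^ (i - 1)"
    proof (intro add_mono diff_mono mult_left_mono choose_le_power)
      have "(1 - \<delta> / 2) * (real (t * ?s) ^ i / fact i)
          \<le> (real (t choose i) * fact i / real t ^ i) * (real (t * ?s) ^ i / fact i)"
        using t(2) by (intro mult_right_mono) auto
      also have "\<dots> = real (t choose i) * real ?s ^ i" unfolding s by simp
      finally show "(1 - \<delta> / 2) * (real (t * ?s) ^ i / fact i) \<le> real (t choose i) * real ?s ^ i" .
      have "real ((t * ?s) choose (i - 1)) \<le> real (t * ?s) ^ (i - 1) / fact (i - 1)" by (rule choose_le_power)
      also have "\<dots> \<le> real (t * ?s) ^ (i - 1)"
        using divide_left_mono[OF fact_ge_1, of "real (t * ?s) ^ (i - 1)" "i - 1"] by simp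
      finally show "real ((t * ?s) choose (i - 1)) \<le> real (t * ?s) ^ (i - 1)" .
    qed (use a in auto)
    also have "\<dots> = (saving i + (1 - saving i) * (\<delta> / 2)) / fact i * real (t * ?s) ^ i
         + real i * real t * real (t * ?s) ^ (i - 1)"
      by (simp add: field_simps)
    also have "\<dots> \<le> C N"
    proof -
      have "(1 - saving i) * (\<delta> / 2) \<le> \<delta> / 2" using a assms by (simp add: mult_left_le_one_le)
      then show ?thesis unfolding C_def using a assms M
        by (intro add_mono mult_mono power_mono divide_right_mono mult_nonneg_nonneg) auto
    qed
    finally show ?thesis by (rule box_sum_mono[OF box_sum_even[OF A(1) N]])
  qed
  have Mlim: "(\<lambda>N. M N / real N) \<longlonglongrightarrow> 1"
  proof -
    have "(\<lambda>N. 1 + 15 * real t * inverse (real N)) \<longlonglongrightarrow> 1 + 15 * real t * 0"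
      by (intro tendsto_intros lim_inverse_n)
    moreover have "eventually (\<lambda>N. 1 + 15 * real t * inverse (real N) = M N / real N) sequentially"
      using eventually_gt_at_top[of 0] by eventually_elim (simp add: M_def field_simps)
    ultimately show ?thesis by (simp add: tendsto_cong)
  qed
  have "(\<lambda>N. (saving i + \<delta> / 2) / fact i * (M N / real N) ^ i
             + real i * real t * (M N / real N) ^ (i - 1) * inverse (real N))
        \<longlonglongrightarrow> (saving i + \<delta> / 2) / fact i * 1 ^ i + real i * real t * 1 ^ (i - 1) * 0"
    by (intro tendsto_intros Mlim lim_inverse_n)
  moreover have "eventually (\<lambda>N. (saving i + \<delta> / 2) / fact i * (M N / real N) ^ i
             + real i * real t * (M N / real N) ^ (i - 1) * inverse (real N) = C N / real N ^ i) sequentially"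
    using eventually_gt_at_top[of 0]
  proof eventually_elim
    case (elim N)
    show ?case
    proof (cases i)
      case 0
      then show ?thesis using elim by (simp add: C_def)
    next
      case (Suc k)
      have *: "a * (m / d) ^ Suc k + b * (m / d) ^ k * inverse d = (a * m ^ Suc k + b * m ^ k) / d ^ Suc k"
        if "d > 0" for a b m d :: real
        using that by (simp add: power_divide field_simps)
      then show ?thesis unfolding C_def Suc diff_Suc_1 using elim by (intro *) simp
    qed
  qed
  ultimately have "(\<lambda>N. C N / real N ^ i) \<longlonglongrightarrow> (saving i + \<delta> / 2) / fact i"
    by (simp add: tendsto_cong)
  moreover have "(saving i + \<delta> / 2) / fact i < (saving i + \<delta>) / fact i"
    using assms by (simp add: divide_strict_right_mono)
  ultimately have "eventually (\<lambda>N. C N / real N ^ i < (saving i + \<delta>) / fact i) sequentially"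
    by (rule order_tendstoD(2))
  then show ?thesis using eventually_gt_at_top[of 0]
  proof eventually_elim
    case (elim N)
    then have "C N \<le> (saving i + \<delta>) * real N ^ i / fact i" by (simp add: field_simps)
    then show ?case using bound box_sum_mono by blast
  qed
qed

text \<open>Since \<open>14/15 < (31/32)\<^sup>2\<close>, the savings are dominated by a geometric progression, up to a factor \<open>32/31\<close>
for odd \<open>i\<close>, and the binomial theorem evaluates the sum: \<open>32/31 * (63/64) ^ 56 < 0.43\<close>.\<close>

lemma sum_saving: "(\<Sum>i\<le>56. real (56 choose i) * saving i) \<le> 43 / 100 * 2 ^ 56"
proof -
  let ?g = "31 / 32 :: real"
  have saving_le: "saving i \<le> 32 / 31 * ?g ^ i" for i
  proof -
    have "saving i \<le> (?g ^ 2) ^ (i div 2)" by (intro power_mono) (simp_all add: power2_eq_square)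
    also have "\<dots> = 32 / 31 * ?g ^ Suc (2 * (i div 2))" by (simp add: power_mult)
    also have "?g ^ Suc (2 * (i div 2)) \<le> ?g ^ i" by (rule power_decreasing) auto
    finally show ?thesis by simp
  qed
  have "(\<Sum>i\<le>56. real (56 choose i) * saving i)
      \<le> (\<Sum>i\<le>56. real (56 choose i) * (32 / 31 * ?g ^ i))"
    by (intro sum_mono mult_left_mono saving_le) simp
  also have "\<dots> = 32 / 31 * (?g + 1) ^ 56"
    unfolding binomial_ring by (simp add: sum_distrib_left ac_simps)
  also have "\<dots> \<le> 43 / 100 * 2 ^ 56" by (simp add: power_divide)
  finally show ?thesis .
qed

text \<open>The constant is \<open>2 * (0.43 + 0.01)\<close>: both halves can contain the even part, and 0.01 covers the error in
\<open>box_sum_even_asymptotic\<close>.\<close>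

lemma box_sum_113:
  "eventually (\<lambda>n. box_sum 113 (88 / 100 * (real (n + 1) ^ 56 / fact 56))
     (\<lambda>X. card (X \<inter> {..<n :: nat}) choose 113)) sequentially"
proof -
  let ?\<delta> = "1 / 100 :: real"
  define E where "E = (\<lambda>h i. (saving i + ?\<delta>) * real h ^ i / fact i)"
  have "eventually (\<lambda>h. \<forall>i\<in>{..56}. \<forall>A :: nat set. finite A \<longrightarrow> card A \<le> h \<longrightarrow>
     box_sum (2 * i) (E h i) (\<lambda>X. card (X \<inter> A) choose (2 * i))) sequentially"
    unfolding E_def by (intro eventually_ball_finite ballI box_sum_even_asymptotic) auto
  then obtain h0 where even: "\<And>h i A. h0 \<le> h \<Longrightarrow> i \<le> 56 \<Longrightarrow> finite (A :: nat set) \<Longrightarrow> card A \<le> h \<Longrightarrow>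
     box_sum (2 * i) (E h i) (\<lambda>X. card (X \<inter> A) choose (2 * i))"
    unfolding eventually_sequentially by blast
  show ?thesis
  proof (rule eventually_sequentiallyI)
    fix n assume n: "2 * h0 \<le> n"
    define h where "h = (n + 1) div 2"
    define A B where "A = {..<h}" and "B = {h..<n}"
    have h: "h0 \<le> h" "2 * h \<le> n + 1" using n by (auto simp: h_def)
    have AB: "finite A" "finite B" "card A \<le> h" "card B \<le> h" "A \<inter> B = {}" "{..<n} = A \<union> B"
      by (auto simp: A_def B_def h_def)
    define T where "T = (\<lambda>i. real h ^ i / fact i)"
    have odd: "box_sum (2 * i + 1) (T i) (\<lambda>X. card (X \<inter> D) choose (2 * i + 1))"
      if "finite D" "card D \<le> h" for D :: "nat set" and i
    proof -
      have "real (card D choose i) \<le> T i"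
        using choose_le_power[of "card D" i] that(2) unfolding T_def
        by (meson divide_right_mono fact_ge_zero of_nat_0_le_iff of_nat_mono order_trans power_mono)
      then show ?thesis using box_sum_mono[OF box_sum_choose[OF that(1), of "2 * i + 1"]] by simp
    qed
    let ?f = "\<lambda>b X. (card (X \<inter> A) choose b) * (card (X \<inter> B) choose (113 - b))"
    have 1: "box_sum 113 (E h i * T (56 - i)) (?f (2 * i))" if "i \<le> 56" for i
    proof -
      have "2 * i + (2 * (56 - i) + 1) = 113" and r: "113 - 2 * i = 2 * (56 - i) + 1"
        using that by auto
      then show ?thesis
        unfolding r using box_sum_mult[OF even[OF h(1) that AB(1,3)] odd[OF AB(2,4), of "56 - i"]]
        by (simp only:)
    qed
    have 2: "box_sum 113 (T i * E h (56 - i)) (?f (Suc (2 * i)))" if "i \<le> 56" for i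
    proof -
      have "(2 * i + 1) + 2 * (56 - i) = 113" and r: "113 - Suc (2 * i) = 2 * (56 - i)"
        using that by auto
      then show ?thesis
        unfolding r Suc_eq_plus1
        using box_sum_mult[OF odd[OF AB(1,3), of i] even[OF h(1) diff_le_self AB(2,4), of i]]
        by (simp only:)
    qed
    \<comment> \<open>The case with the even part in \<open>B\<close> mirrors the one with the even part in \<open>A\<close>.\<close>
    have rev: "(\<Sum>i\<le>56. T i * E h (56 - i)) = (\<Sum>i\<le>56. E h i * T (56 - i))"
      by (rule sum.reindex_bij_witness[of _ "\<lambda>i. 56 - i" "\<lambda>i. 56 - i"]) auto
    have "box_sum 113 ((\<Sum>i\<le>56. E h i * T (56 - i)) + (\<Sum>i\<le>56. T i * E h (56 - i)))
       (\<lambda>X. (\<Sum>i\<le>56. ?f (2 * i) X) + (\<Sum>i\<le>56. ?f (Suc (2 * i)) X))"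
      using 1 2 by (intro box_sum_add box_sum_sum) auto
    moreover have "(\<Sum>i\<le>56. E h i * T (56 - i)) + (\<Sum>i\<le>56. T i * E h (56 - i))
       \<le> 88 / 100 * (real (n + 1) ^ 56 / fact 56)"
    proof -
      have "E h i * T (56 - i) = (real (56 choose i) * saving i + ?\<delta> * real (56 choose i)) * (real h ^ 56 / fact 56)"
        if "i \<le> 56" for i
      proof -
        have "real h ^ 56 = real h ^ i * real h ^ (56 - i)" using that by (simp flip: power_add)
        then show ?thesis using that
          by (simp add: E_def T_def binomial_fact field_simps)
      qed
      then have "(\<Sum>i\<le>56. E h i * T (56 - i))
         = (\<Sum>i\<le>56. (real (56 choose i) * saving i + ?\<delta> * real (56 choose i)) * (real h ^ 56 / fact 56))"
        by (intro sum.cong) auto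
      also have "\<dots> = ((\<Sum>i\<le>56. real (56 choose i) * saving i) + ?\<delta> * (\<Sum>i\<le>56. real (56 choose i))) * (real h ^ 56 / fact 56)"
        by (simp only: sum.distrib sum_distrib_left sum_distrib_right[symmetric])
      also have "(\<Sum>i\<le>56. real (56 choose i)) = 2 ^ 56"
        using choose_row_sum[of 56] by (metis of_nat_numeral of_nat_power of_nat_sum)
      also have "((\<Sum>i\<le>56. real (56 choose i) * saving i) + ?\<delta> * 2 ^ 56) * (real h ^ 56 / fact 56)
         \<le> (44 / 100 * 2 ^ 56) * (real h ^ 56 / fact 56)"
        using sum_saving by (intro mult_right_mono) auto
      also have "\<dots> = 44 / 100 * (real (2 * h) ^ 56 / fact 56)" by (simp add: power_mult_distrib)
      also have "\<dots> \<le> 44 / 100 * (real (n + 1) ^ 56 / fact 56)"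
        using h(2) by (intro mult_left_mono divide_right_mono power_mono of_nat_mono) auto
      finally show ?thesis unfolding rev by simp
    qed
    ultimately have "box_sum 113 (88 / 100 * (real (n + 1) ^ 56 / fact 56))
       (\<lambda>X. (\<Sum>i\<le>56. ?f (2 * i) X) + (\<Sum>i\<le>56. ?f (Suc (2 * i)) X))"
      by (rule box_sum_mono)
    then show "box_sum 113 (88 / 100 * (real (n + 1) ^ 56 / fact 56)) (\<lambda>X. card (X \<inter> {..<n}) choose 113)"
    proof (rule box_sum_cong)
      fix X :: "nat set" assume X: "finite X"
      have "card (X \<inter> {..<n}) choose 113 = (\<Sum>b\<le>Suc (2 * 56). ?f b X)"
        using card_Int_Un_choose[OF X AB(5), of 113] AB(6) by simp
      then show "card (X \<inter> {..<n}) choose 113 = (\<Sum>i\<le>56. ?f (2 * i) X) + (\<Sum>i\<le>56. ?f (Suc (2 * i)) X)"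
        unfolding sum_even_odd(1)[of "\<lambda>b. ?f b X" 56] .
    qed
  qed
qed

theorem mainTheorem2:
  shows "\<exists>c::real. c < 1 \<and>
    (\<exists>\<epsilon> :: nat \<Rightarrow> real. \<epsilon> \<in> o(\<lambda>_. 1) \<and>
      (\<forall>n. real (min_blocks 113 n) \<le> c * (1 + \<epsilon> n) * real (n choose 56)))"
proof -
  let ?c = "9 / 10 :: real"
  define good where "good = (\<lambda>n. real (min_blocks 113 n) \<le> ?c * real (n choose 56))"
  \<comment> \<open>For the finitely many other \<open>n\<close> the standard bound \<open>n choose 56\<close> suffices, as \<open>9/10 * (1 + 1/9) = 1\<close>.\<close>
  define \<epsilon> :: "nat \<Rightarrow> real" where "\<epsilon> = (\<lambda>n. if good n then 0 else 1 / 9)"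
  have "(\<lambda>n. real (n choose 56) * fact 56 / real n ^ 56 * (real n / real (Suc n)) ^ 56)
      \<longlonglongrightarrow> 1 * 1 ^ 56"
    by (intro tendsto_mult tendsto_power choose_asymptotics LIMSEQ_n_over_Suc_n)
  then have "eventually (\<lambda>n. 88 / 90 <
      real (n choose 56) * fact 56 / real n ^ 56 * (real n / real (Suc n)) ^ 56) sequentially"
    by (rule order_tendstoD(1)) simp
  then have "eventually good sequentially"
    using box_sum_113 eventually_gt_at_top[of 0]
  proof eventually_elim
    case (elim n)
    have "88 / 90 < real (n choose 56) * fact 56 / real (n + 1) ^ 56"
      using elim(1,3) by (simp add: power_divide)
    then have "88 / 90 * real (n + 1) ^ 56 < real (n choose 56) * fact 56"
      by (subst (asm) pos_less_divide_eq) simp_all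
    then have "88 / 90 * (real (n + 1) ^ 56 / fact 56) \<le> real (n choose 56)"
      by (simp add: pos_divide_le_eq)
    then show ?case
      using min_blocks_le_box_sum[OF elim(2)] by (simp add: good_def)
  qed
  then have "eventually (\<lambda>n. \<epsilon> n = 0) sequentially"
    by eventually_elim (simp add: \<epsilon>_def)
  then have "\<epsilon> \<in> o(\<lambda>_. 1)"
    by (subst landau_o.small.in_cong[of _ "\<lambda>_. 0"]) auto
  moreover have "real (min_blocks 113 n) \<le> ?c * (1 + \<epsilon> n) * real (n choose 56)" for n
  proof (cases "good n")
    case True
    then show ?thesis by (simp add: \<epsilon>_def good_def)
  next
    case False
    have "real (min_blocks 113 n) \<le> real (n choose 56)"
      using min_blocks_le_box_sum[OF box_sum_choose[of "{..<n}" 113]] by simp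
    then show ?thesis using False by (simp add: \<epsilon>_def)
  qed
  moreover have "?c < 1" by simp
  ultimately show ?thesis by blast
qed

end
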